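(* Let $\phi$ be a symmetric nonnegative function on pairs of positive integers, not depending on $N$, such that $c(\eta):=\sum_{1\le i\le j,\ i+j\le N}n_{i+j}\phi(i,j)>0$ for every $N\ge2$ and every partition $\eta=(n_1,\dots,n_N)\in\Omega_N$ other than $(N,0,\dots,0)$, and set $$P_F(\eta\to\eta_{(i,j)})=\frac{n_{i+j}\,\phi(i,j)}{c(\eta)},\quad \eta=(n_1,\dots,n_N)\in\Omega_N .$$ Let $(a_k)_{k\ge1}$ be a sequence of positive weights, not depending on $N$, normalized by $a_1=1$, and let $\rho_{N,r}$ be the associated Gibbs distributions $$\rho_{N,r}(\eta)=\frac1{B_{N,r}}\prod_{k=1}^N\frac{a_k^{n_k}}{n_k!},\quad \eta=(n_1,\dots,n_N)\in\Omega_{N,r},\ 1\le r\le N,$$ where $B_{N,r}$ is the normalizing constant. Then the distributions $\rho_{N,r}$ satisfy $$\rho_{N,r+1}(\zeta)=\sum_{\eta\in\Omega_{N,r}:\ \eta\sim\zeta}\rho_{N,r}(\eta)\,P_F(\eta\to\zeta),\quad \zeta\in\Omega_{N,r+1},\ r=1,\dots,N-1,$$ for all $N\ge 1$ if and only if there are constants $a\ge0$ and $b$ with $2a+b>0$ such that $$a_k=\frac{(ak+b)\sum_{i+j=k}a_ia_j}{2(k-1)},\quad k\ge2,\qquad a_1=1$$ (the sum being over ordered pairs $i,j\ge1$), and $$\phi(i,j)=\phi(1,1)\,\frac{a_ia_j}{a_{i+j}}\,\big(a(i+j)+b\big)\ (i\ne j),\qquad \phi(i,i)=\phi(1,1)\,\frac{a_i^2}{2a_{2i}}\,(2ai+b),\qquad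 i,j\ge1.$$
   Context: For $N\ge1$, $\Omega_N$ is the set of all partitions of $N$, i.e. vectors $\eta=(n_1,\dots,n_N)$ of nonnegative integers with $\sum_{i=1}^N i n_i=N$; $|\eta|=\sum_i n_i$ and $\Omega_{N,r}=\{\eta\in\Omega_N:|\eta|=r\}$. For $\eta$ with $n_{i+j}>0$, $\eta_{(i,j)}$ denotes the partition obtained from $\eta$ by splitting (fragmenting) a group of size $i+j$ into two groups of sizes $i$ and $j$. States $\eta\in\Omega_{N,r}$, $\zeta\in\Omega_{N,r+1}$ are neighbours, $\eta\sim\zeta$, if $\zeta=\eta_{(i,j)}$ for some $i,j$. $P_F(\eta\to\zeta)$ is the one-step transition probability of a fragmentation from $\eta$ to $\zeta$. *)

theory Defs
  imports Complex_Main
begin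

text \<open>A partition of \<open>N\<close> is represented by its vector of multiplicities \<open>(n\<^sub>1, \<dots>, n\<^sub>N)\<close>, as
  a function \<open>nat \<Rightarrow> nat\<close> that vanishes outside \<open>{1..N}\<close>.\<close>

definition partitions :: "nat \<Rightarrow> (nat \<Rightarrow> nat) set"  (\<open>\<Omega>\<close>)
  where "\<Omega> N = {\<eta>. (\<forall>k. k \<notin> {1..N} \<longrightarrow> \<eta> k = 0) \<and> (\<Sum>k=1..N. k * \<eta> k) = N}"

definition num_groups :: "nat \<Rightarrow> (nat \<Rightarrow> nat) \<Rightarrow> nat"
  where "num_groups N \<eta> = (\<Sum>k=1..N. \<eta> k)"

definition partitions_into :: "nat \<Rightarrow> nat \<Rightarrow> (nat \<Rightarrow> nat) set"
  where "partitions_into N r = {\<eta> \<in> \<Omega> N. num_groups N \<eta> = r}"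

definition all_singletons :: "nat \<Rightarrow> nat \<Rightarrow> nat"
  where "all_singletons N = (\<lambda>k. if k = 1 then N else 0)"

text \<open>Only meaningful for \<open>i, j \<ge> 1\<close> and \<open>\<eta> (i + j) > 0\<close>; then the subtraction does not truncate.
  For \<open>i = j\<close> two groups of size \<open>i\<close> are added.\<close>

definition fragment :: "(nat \<Rightarrow> nat) \<Rightarrow> nat \<Rightarrow> nat \<Rightarrow> (nat \<Rightarrow> nat)"
  where "fragment \<eta> i j =
    (\<lambda>k. \<eta> k - of_bool (k = i + j) + of_bool (k = i) + of_bool (k = j))"

definition neighbours :: "(nat \<Rightarrow> nat) \<Rightarrow> (nat \<Rightarrow> nat) \<Rightarrow> bool"  (infix \<open>\<leadsto>\<close> 50)
  where "\<eta> \<leadsto> \<zeta> \<longleftrightarrow> (\<exists>i\<ge>1. \<exists>j\<ge>1. \<eta> (i + j) > 0 \<and> \<zeta> = fragment \<eta> i j)"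

definition total_rate :: "(nat \<Rightarrow> nat \<Rightarrow> real) \<Rightarrow> nat \<Rightarrow> (nat \<Rightarrow> nat) \<Rightarrow> real"
  where "total_rate \<phi> N \<eta> =
    (\<Sum>(i, j) \<in> {(i, j). 1 \<le> i \<and> i \<le> j \<and> i + j \<le> N}. real (\<eta> (i + j)) * \<phi> i j)"

text \<open>The transition probability is a function of the two states. The index set below has at most
  one element, because \<open>\<zeta>\<close> determines the unordered pair \<open>{i, j}\<close>; see the lemma
  \<open>P_F_fragment\<close>. The value is \<open>0\<close> if \<open>\<zeta>\<close> does not arise from \<open>\<eta>\<close> by a fragmentation.\<close>

definition P_F :: "(nat \<Rightarrow> nat \<Rightarrow> real) \<Rightarrow> nat \<Rightarrow> (nat \<Rightarrow> nat) \<Rightarrow> (nat \<Rightarrow> nat) \<Rightarrow> real"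
  where "P_F \<phi> N \<eta> \<zeta> =
    (\<Sum>(i, j) \<in> {(i, j). 1 \<le> i \<and> i \<le> j \<and> i + j \<le> N \<and> \<eta> (i + j) > 0 \<and> \<zeta> = fragment \<eta> i j}.
       real (\<eta> (i + j)) * \<phi> i j / total_rate \<phi> N \<eta>)"

definition gibbs_weight :: "(nat \<Rightarrow> real) \<Rightarrow> nat \<Rightarrow> (nat \<Rightarrow> nat) \<Rightarrow> real"
  where "gibbs_weight a N \<eta> = (\<Prod>k=1..N. a k ^ \<eta> k / fact (\<eta> k))"

definition gibbs_norm :: "(nat \<Rightarrow> real) \<Rightarrow> nat \<Rightarrow> nat \<Rightarrow> real"
  where "gibbs_norm a N r = (\<Sum>\<eta> \<in> partitions_into N r. gibbs_weight a N \<eta>)"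

definition gibbs :: "(nat \<Rightarrow> real) \<Rightarrow> nat \<Rightarrow> nat \<Rightarrow> (nat \<Rightarrow> nat) \<Rightarrow> real"  (\<open>\<rho>\<close>)
  where "\<rho> a N r \<eta> = gibbs_weight a N \<eta> / gibbs_norm a N r"

lemma fragment_commute: "fragment \<eta> i j = fragment \<eta> j i"
  by (auto simp: fragment_def fun_eq_iff add.commute)

lemma fragment_inject:
  assumes "1 \<le> i" "i \<le> j" "\<eta> (i + j) > 0" "1 \<le> i'" "i' \<le> j'" "\<eta> (i' + j') > 0"
    and eq: "fragment \<eta> i j = fragment \<eta> i' j'"
  shows "i = i' \<and> j = j'"
proof -
  have down: "fragment \<eta> p q k < \<eta> k \<longleftrightarrow> k = p + q"
    if "1 \<le> p" "1 \<le> q" "\<eta> (p + q) > 0" for p q k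
    using that by (auto simp: fragment_def)
  have s: "i + j = i' + j'"
    using down[of i j "i + j"] down[of i' j' "i + j"] assms by auto
  have up: "fragment \<eta> p q k > \<eta> k \<longleftrightarrow> k = p \<or> k = q"
    if "1 \<le> p" "1 \<le> q" "\<eta> (p + q) > 0" for p q k
    using that by (auto simp: fragment_def)
  have "i = i' \<or> i = j'" "i' = i \<or> i' = j"
    using up[of i j i] up[of i' j' i] up[of i j i'] up[of i' j' i'] assms by auto
  with s assms show ?thesis by linarith
qed

lemma P_F_fragment:
  assumes sym: "\<phi> i j = \<phi> j i"
    and "1 \<le> i" "1 \<le> j" "\<eta> (i + j) > 0" "\<eta> \<in> \<Omega> N"
  shows "P_F \<phi> N \<eta> (fragment \<eta> i j) = real (\<eta> (i + j)) * \<phi> i j / total_rate \<phi> N \<eta>"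
proof -
  have N: "i + j \<le> N"
  proof (rule ccontr)
    assume "\<not> i + j \<le> N"
    then have "i + j \<notin> {1..N}" by simp
    with assms(5) have "\<eta> (i + j) = 0" unfolding partitions_def by blast
    with assms(4) show False by simp
  qed
  have main: "P_F \<phi> N \<eta> (fragment \<eta> p q) = real (\<eta> (p + q)) * \<phi> p q / total_rate \<phi> N \<eta>"
    if "1 \<le> p" "p \<le> q" "\<eta> (p + q) > 0" "p + q \<le> N" for p q
  proof -
    have "{(i, j). 1 \<le> i \<and> i \<le> j \<and> i + j \<le> N \<and> \<eta> (i + j) > 0
             \<and> fragment \<eta> p q = fragment \<eta> i j} = {(p, q)}"
      (is "?S = _")
    proof (intro equalityI subsetI)
      fix x assume "x \<in> ?S"
      then obtain i' j' where x: "x = (i', j')" and "1 \<le> i'" "i' \<le> j'" "\<eta> (i' + j') > 0"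
        "fragment \<eta> p q = fragment \<eta> i' j'" by blast
      with fragment_inject[of p q \<eta> i' j'] that have "p = i' \<and> q = j'" by blast
      with x show "x \<in> {(p, q)}" by blast
    next
      fix x assume "x \<in> {(p, q)}"
      with that show "x \<in> ?S" by blast
    qed
    then show ?thesis by (simp only: P_F_def) simp
  qed
  show ?thesis
  proof (cases "i \<le> j")
    case True
    then show ?thesis using main[of i j] assms N by simp
  next
    case False
    then show ?thesis
      using main[of j i] assms N by (simp add: add.commute fragment_commute[of \<eta> i j])
  qed
qed

end

theory Submission
  imports Defs
begin

text \<open>
  For Gibbs weights \<open>w\<close>, moving a fragmentation backwards replaces \<open>w(\<eta>) n\<^sub>i\<^sub>+\<^sub>j\<close> by \<open>w(\<zeta>)\<close> times the
  number of pairs of groups of sizes \<open>i, j\<close> in \<open>\<zeta>\<close> and the factor \<open>a\<^sub>i\<^sub>+\<^sub>j / (a\<^sub>i a\<^sub>j)\<close>. The balance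
  equations therefore say that the sum over pairs \<open>{i, j}\<close> of groups of \<open>\<zeta>\<close> of \<open>\<Psi>(i, j) / c(\<eta>)\<close>, with
  \<open>\<Psi>(i, j) = (1 + \<delta>\<^sub>i\<^sub>j) \<phi>(i, j) a\<^sub>i\<^sub>+\<^sub>j / (a\<^sub>i a\<^sub>j)\<close> and \<open>\<eta>\<close> the result of merging the pair, depends on \<open>N\<close>
  and \<open>r\<close> only. Write \<open>c(\<eta>) = \<Sum>\<^sub>m n\<^sub>m f(m)\<close>.

  Necessity: \<open>r = 1\<close> gives \<open>\<Psi>(i, j) = g(i + j)\<close>. Comparing \<open>{k + 1, 1, 1\<^sup>n}\<close> with \<open>{k, 2, 1\<^sup>n}\<close> for varying
  \<open>n\<close> gives \<open>f(k + 1) = f(k) + f(2)\<close>, so \<open>f(k) = \<phi>(1, 1) (k - 1)\<close>, which is the recursion for \<open>a\<close>. Then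
  \<open>c\<close> is constant on each class, and the partitions \<open>{1, 1, k + 2}\<close> and \<open>{1, 2, k + 1}\<close> show that \<open>g\<close> is
  affine; positivity of \<open>g\<close> forces a nonnegative slope.

  Sufficiency: the same formulas make the sum over pairs a positive constant, which is identified
  by summing over \<open>\<zeta>\<close>, as the transition probabilities out of each \<open>\<eta>\<close> sum to \<open>1\<close>.
\<close>

section \<open>Fragmentation as adding groups to a common remainder\<close>

text \<open>Both states of a fragmentation arise by adding groups to the same remainder, so the
  truncated subtraction in \<open>fragment\<close> disappears.\<close>

definition add_group :: "nat \<Rightarrow> (nat \<Rightarrow> nat) \<Rightarrow> nat \<Rightarrow> nat"
  where "add_group k \<theta> = \<theta>(k := Suc (\<theta> k))"

lemma add_group_apply: "add_group k \<theta> x = \<theta> x + of_bool (x = k)"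
  by (simp add: add_group_def)

lemma add_group_inject: "add_group k \<theta> = add_group k \<theta>' \<longleftrightarrow> \<theta> = \<theta>'"
  by (auto simp: add_group_apply fun_eq_iff)

lemma obtain_add_group:
  assumes "\<eta> k > 0"
  obtains \<theta> where "\<eta> = add_group k \<theta>"
proof
  show "\<eta> = add_group k (\<eta>(k := \<eta> k - 1))"
    using assms by (auto simp: add_group_def)
qed

lemma fragment_add_group:
  assumes "i \<ge> 1" "j \<ge> 1"
  shows "fragment (add_group (i + j) \<theta>) i j = add_group j (add_group i \<theta>)"
  using assms by (auto simp: fragment_def add_group_apply fun_eq_iff)

text \<open>The uninvolved groups form \<open>\<theta>\<close>. As adding a group is injective,
  \<open>\<zeta>\<close> and the pair \<open>i\<close>, \<open>j\<close> determine the predecessor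
  \<open>\<eta>\<close>.\<close>

lemma fragment_eq_iff:
  assumes "i \<ge> 1" "j \<ge> 1"
  shows "\<eta> (i + j) > 0 \<and> \<zeta> = fragment \<eta> i j \<longleftrightarrow>
    (\<exists>\<theta>. \<eta> = add_group (i + j) \<theta> \<and> \<zeta> = add_group j (add_group i \<theta>))"
proof
  assume *: "\<eta> (i + j) > 0 \<and> \<zeta> = fragment \<eta> i j"
  then obtain \<theta> where "\<eta> = add_group (i + j) \<theta>"
    using obtain_add_group by blast
  with * assms show "\<exists>\<theta>. \<eta> = add_group (i + j) \<theta> \<and> \<zeta> = add_group j (add_group i \<theta>)"
    by (auto simp: fragment_add_group)
next
  assume "\<exists>\<theta>. \<eta> = add_group (i + j) \<theta> \<and> \<zeta> = add_group j (add_group i \<theta>)"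
  with assms show "\<eta> (i + j) > 0 \<and> \<zeta> = fragment \<eta> i j"
    by (auto simp: fragment_add_group add_group_apply)
qed

text \<open>The number of ordered pairs of distinct groups of sizes \<open>i\<close> and \<open>j\<close>. The subtraction takes
  place in the reals; at \<open>\<zeta> i = 0\<close>, \<open>i = j\<close> the first factor makes the product vanish.\<close>

definition pair_count :: "(nat \<Rightarrow> nat) \<Rightarrow> nat \<Rightarrow> nat \<Rightarrow> real"
  where "pair_count \<zeta> i j = real (\<zeta> j) * (real (\<zeta> i) - of_bool (i = j))"

lemma pair_count_commute: "pair_count \<zeta> i j = pair_count \<zeta> j i"
  by (auto simp: pair_count_def)

lemma obtain_add_group2:
  assumes "pair_count \<zeta> i j \<noteq> 0"
  obtains \<theta> where "\<zeta> = add_group j (add_group i \<theta>)"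
proof -
  have "\<zeta> j > 0" using assms by (auto simp: pair_count_def)
  then obtain \<theta>' where z: "\<zeta> = add_group j \<theta>'" using obtain_add_group by blast
  have "\<theta>' i > 0"
    using assms z by (cases "i = j") (auto simp: pair_count_def add_group_apply)
  then obtain \<theta> where "\<theta>' = add_group i \<theta>" using obtain_add_group by blast
  with z that show ?thesis by blast
qed

text \<open>Total size, number of groups and total rate all have this linear form, with natural or
  real values.\<close>

lemma sum_add_group:
  fixes h :: "nat \<Rightarrow> 'a :: comm_semiring_1"
  assumes "finite A" "k \<in> A"
  shows "(\<Sum>x\<in>A. of_nat (add_group k \<theta> x) * h x) = h k + (\<Sum>x\<in>A. of_nat (\<theta> x) * h x)"
proof -
  have "(\<Sum>x\<in>A. of_nat (add_group k \<theta> x) * h x)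
      = (\<Sum>x\<in>A. of_nat (\<theta> x) * h x + (if x = k then h x else 0))"
    by (intro sum.cong) (auto simp: add_group_apply algebra_simps)
  also have "\<dots> = (\<Sum>x\<in>A. of_nat (\<theta> x) * h x) + h k"
    using assms by (simp add: sum.distrib sum.delta')
  finally show ?thesis by (simp add: add.commute)
qed

lemma weight_add_group:
  assumes "k \<in> {1..N}"
  shows "(\<Sum>x=1..N. x * add_group k \<theta> x) = k + (\<Sum>x=1..N. x * \<theta> x)"
  using sum_add_group[OF finite_atLeastAtMost assms, of \<theta> "\<lambda>x. x"]
  by (simp add: mult.commute)

lemma num_groups_add_group:
  assumes "k \<in> {1..N}"
  shows "num_groups N (add_group k \<theta>) = Suc (num_groups N \<theta>)"
  using sum_add_group[OF finite_atLeastAtMost assms, of \<theta> "\<lambda>x. 1 :: nat"]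
  by (simp add: num_groups_def)

text \<open>Total sizes agree, the numbers of groups differ by one, and \<open>i\<close>,
  \<open>j\<close>, \<open>i + j\<close> all lie in \<open>{1..N}\<close>, so the support conditions
  agree too.\<close>

lemma partitions_into_fragment_iff:
  assumes "i \<ge> 1" "j \<ge> 1" "i + j \<le> N"
  shows "add_group (i + j) \<theta> \<in> partitions_into N r \<longleftrightarrow>
    add_group j (add_group i \<theta>) \<in> partitions_into N (Suc r)"
proof -
  have "(\<forall>k. k \<notin> {1..N} \<longrightarrow> add_group (i + j) \<theta> k = 0) \<longleftrightarrow>
        (\<forall>k. k \<notin> {1..N} \<longrightarrow> add_group j (add_group i \<theta>) k = 0)"
    using assms by (auto simp: add_group_apply)
  moreover have "(\<Sum>x=1..N. x * add_group (i + j) \<theta> x) = (\<Sum>x=1..N. x * add_group j (add_group i \<theta>) x)"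
    using assms by (simp add: weight_add_group del: One_nat_def)
  moreover have "num_groups N (add_group j (add_group i \<theta>)) = Suc (num_groups N (add_group (i + j) \<theta>))"
    using assms by (simp add: num_groups_add_group)
  ultimately show ?thesis
    by (simp add: partitions_into_def partitions_def)
qed

lemma partition_add_group2_bounds:
  assumes "add_group j (add_group i \<theta>) \<in> \<Omega> N"
  shows "i \<ge> 1" "j \<ge> 1" "i + j \<le> N"
proof -
  have *: "add_group j (add_group i \<theta>) k = 0" if "k \<notin> {1..N}" for k
    using assms that unfolding partitions_def by blast
  have i: "i \<in> {1..N}" and j: "j \<in> {1..N}"
    using *[of i] *[of j] by (auto simp: add_group_apply simp del: atLeastAtMost_iff)
  then show "i \<ge> 1" "j \<ge> 1" by auto
  have "i + j + (\<Sum>x=1..N. x * \<theta> x) = N"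
    using assms i j weight_add_group[OF j, of "add_group i \<theta>"] weight_add_group[OF i, of \<theta>]
    unfolding partitions_def by simp
  then show "i + j \<le> N" by linarith
qed

lemma finite_partitions: "finite (\<Omega> N)"
proof (rule finite_subset)
  show "\<Omega> N \<subseteq> {f. \<forall>x. (x \<in> {1..N} \<longrightarrow> f x \<in> {0..N}) \<and> (x \<notin> {1..N} \<longrightarrow> f x = 0)}"
  proof (intro subsetI CollectI allI conjI impI)
    fix \<eta> x assume \<eta>: "\<eta> \<in> \<Omega> N" and x: "x \<in> {1..N}"
    have "\<eta> x \<le> x * \<eta> x" using x by simp
    also have "\<dots> \<le> (\<Sum>k=1..N. k * \<eta> k)"
      by (rule member_le_sum[OF x]) auto
    also have "\<dots> = N" using \<eta> by (simp add: partitions_def)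
    finally show "\<eta> x \<in> {0..N}" by simp
  qed (auto simp: partitions_def)
  show "finite {f. \<forall>x. (x \<in> {1..N} \<longrightarrow> f x \<in> {0..N}) \<and> (x \<notin> {1..N} \<longrightarrow> f x = (0::nat))}"
    by (intro finite_set_of_finite_funs) auto
qed

lemma finite_partitions_into: "finite (partitions_into N r)"
  using finite_partitions by (simp add: partitions_into_def)

section \<open>Gibbs weights under fragmentation\<close>

lemma gibbs_weight_add_group:
  assumes "k \<in> {1..N}"
  shows "gibbs_weight a N (add_group k \<theta>) * real (Suc (\<theta> k)) = gibbs_weight a N \<theta> * a k"
proof -
  let ?Q = "\<Prod>x\<in>{1..N} - {k}. a x ^ \<theta> x / fact (\<theta> x)"
  have "gibbs_weight a N (add_group k \<theta>) = a k ^ Suc (\<theta> k) / fact (Suc (\<theta> k)) * ?Q"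
    unfolding gibbs_weight_def using assms
    by (subst prod.remove[of _ k]) (auto simp: add_group_apply intro!: prod.cong)
  then have "gibbs_weight a N (add_group k \<theta>) * real (Suc (\<theta> k))
      = a k ^ Suc (\<theta> k) / fact (Suc (\<theta> k)) * real (Suc (\<theta> k)) * ?Q"
    by (simp only: mult_ac)
  also have "a k ^ Suc (\<theta> k) / fact (Suc (\<theta> k)) * real (Suc (\<theta> k)) = a k ^ \<theta> k / fact (\<theta> k) * a k"
    by (simp del: of_nat_Suc)
  also have "\<dots> * ?Q = a k ^ \<theta> k / fact (\<theta> k) * ?Q * a k"
    by (simp only: mult_ac)
  also have "a k ^ \<theta> k / fact (\<theta> k) * ?Q = gibbs_weight a N \<theta>"
    unfolding gibbs_weight_def using assms by (subst prod.remove[of _ k]) auto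
  finally show ?thesis .
qed

text \<open>Both sides equal the weight of \<open>\<theta>\<close> times
  \<open>a i * a j * a (i + j)\<close>.\<close>

lemma gibbs_weight_fragment:
  assumes "i \<ge> 1" "j \<ge> 1" "i + j \<le> N"
  shows "gibbs_weight a N (add_group (i + j) \<theta>) * real (add_group (i + j) \<theta> (i + j)) * (a i * a j)
    = gibbs_weight a N (add_group j (add_group i \<theta>)) * pair_count (add_group j (add_group i \<theta>)) i j * a (i + j)"
proof -
  have "gibbs_weight a N (add_group (i + j) \<theta>) * real (Suc (\<theta> (i + j))) = gibbs_weight a N \<theta> * a (i + j)"
    "gibbs_weight a N (add_group i \<theta>) * real (Suc (\<theta> i)) = gibbs_weight a N \<theta> * a i"
    "gibbs_weight a N (add_group j (add_group i \<theta>)) * real (Suc (add_group i \<theta> j))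
      = gibbs_weight a N (add_group i \<theta>) * a j"
    using assms by (simp_all add: gibbs_weight_add_group del: of_nat_Suc)
  moreover have "pair_count (add_group j (add_group i \<theta>)) i j
      = real (Suc (add_group i \<theta> j)) * real (Suc (\<theta> i))"
    by (auto simp: pair_count_def add_group_apply)
  moreover have "add_group (i + j) \<theta> (i + j) = Suc (\<theta> (i + j))"
    by (simp add: add_group_apply)
  ultimately show ?thesis
    by (smt (verit) mult.assoc mult.commute)
qed

text \<open>The triangle and its reflection cover the square, with the diagonal counted
  twice.\<close>

lemma sum_triangle_eq_half_square:
  fixes h :: "'a::linorder \<Rightarrow> 'a \<Rightarrow> real"
  assumes fin: "finite S" and sym: "\<And>i j. (i, j) \<in> S \<Longrightarrow> (j, i) \<in> S \<and> h i j = h j i"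
  shows "(\<Sum>(i, j) \<in> {(i, j) \<in> S. i \<le> j}. h i j) = (\<Sum>(i, j) \<in> S. (1 + of_bool (i = j)) * h i j) / 2"
proof -
  have le: "finite {(i, j) \<in> S. i \<le> j}" and ge: "finite {(i, j) \<in> S. j \<le> i}"
    using fin by (auto intro: finite_subset[of _ S])
  have swap: "(\<Sum>(i, j) \<in> {(i, j) \<in> S. j \<le> i}. h i j) = (\<Sum>(i, j) \<in> {(i, j) \<in> S. i \<le> j}. h i j)"
    by (rule sum.reindex_bij_witness[of _ prod.swap prod.swap]) (use sym in auto)
  have "(\<Sum>(i, j) \<in> {(i, j) \<in> S. i \<le> j}. h i j) + (\<Sum>(i, j) \<in> {(i, j) \<in> S. j \<le> i}. h i j)
      = (\<Sum>(i, j) \<in> S. if i \<le> j then h i j else 0) + (\<Sum>(i, j) \<in> S. if j \<le> i then h i j else 0)"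
    using fin by (intro arg_cong2[where f = "(+)"] sum.mono_neutral_cong_left) (auto split: if_splits)
  also have "\<dots> = (\<Sum>(i, j) \<in> S. (1 + of_bool (i = j)) * h i j)"
    unfolding sum.distrib[symmetric] by (intro sum.cong) auto
  finally show ?thesis using swap by simp
qed

section \<open>Fragmentation rates and backward rates\<close>

text \<open>This is \<open>f(m)\<close>, the contribution of one group of size \<open>m\<close> to
  \<open>c(\<eta>)\<close>.\<close>

definition group_rate :: "(nat \<Rightarrow> nat \<Rightarrow> real) \<Rightarrow> nat \<Rightarrow> real"
  where "group_rate \<phi> m = (\<Sum>(i, j) \<in> {(i, j). 1 \<le> i \<and> i \<le> j \<and> i + j = m}. \<phi> i j)"

lemma finite_pairs_le: "finite {(i, j). 1 \<le> i \<and> i \<le> j \<and> i + j \<le> (N::nat)}"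
  by (rule finite_subset[of _ "{0..N} \<times> {0..N}"]) auto

lemma total_rate_eq: "total_rate \<phi> N \<eta> = (\<Sum>m=1..N. real (\<eta> m) * group_rate \<phi> m)"
proof -
  let ?T = "{(i, j). 1 \<le> i \<and> i \<le> j \<and> i + j \<le> N}"
  have "total_rate \<phi> N \<eta> = (\<Sum>m=1..N. \<Sum>(i, j) \<in> {p \<in> ?T. (case p of (i, j) \<Rightarrow> i + j) = m}. real (\<eta> (i + j)) * \<phi> i j)"
    unfolding total_rate_def by (rule sum.group[symmetric]) (use finite_pairs_le in auto)
  also have "\<dots> = (\<Sum>m=1..N. real (\<eta> m) * group_rate \<phi> m)"
    unfolding group_rate_def sum_distrib_left
    by (intro sum.cong refl) auto
  finally show ?thesis .
qed

lemma total_rate_add_group: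
  assumes "k \<in> {1..N}"
  shows "total_rate \<phi> N (add_group k \<theta>) = group_rate \<phi> k + total_rate \<phi> N \<theta>"
  unfolding total_rate_eq by (rule sum_add_group[OF finite_atLeastAtMost assms])

text \<open>This is \<open>\<Psi>(i, j)\<close>. Doubling the diagonal lets one formula stand for
  the cases \<open>i \<noteq> j\<close> and \<open>i = j\<close> of the theorem.\<close>

definition pair_rate :: "(nat \<Rightarrow> real) \<Rightarrow> (nat \<Rightarrow> nat \<Rightarrow> real) \<Rightarrow> nat \<Rightarrow> nat \<Rightarrow> real"
  where "pair_rate a \<phi> i j = (1 + of_bool (i = j)) * \<phi> i j * a (i + j) / (a i * a j)"

text \<open>This is \<open>\<Sum>\<^sub>\<eta> w(\<eta>) P\<^sub>F(\<eta> \<rightarrow> \<zeta>) / w(\<zeta>)\<close> for the Gibbs weights \<open>w\<close>: a predecessor \<open>\<eta>\<close> merges two groups of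
  \<open>\<zeta>\<close>, and the denominator is \<open>c(\<eta>)\<close>. The factor \<open>1 / 2\<close> accounts for ordered pairs, and the factor
  \<open>1 + of_bool (i = j)\<close> in \<open>pair_rate\<close> for unordered pairs on the diagonal.\<close>

definition backward_rate :: "(nat \<Rightarrow> real) \<Rightarrow> (nat \<Rightarrow> nat \<Rightarrow> real) \<Rightarrow> nat \<Rightarrow> (nat \<Rightarrow> nat) \<Rightarrow> real"
  where "backward_rate a \<phi> N \<zeta> = (\<Sum>(i, j) \<in> {1..N} \<times> {1..N}. pair_count \<zeta> i j * (pair_rate a \<phi> i j /
    (total_rate \<phi> N \<zeta> - group_rate \<phi> i - group_rate \<phi> j + group_rate \<phi> (i + j)))) / 2"

lemma P_F_eq_0:
  assumes "\<not> \<eta> \<leadsto> \<zeta>"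
  shows "P_F \<phi> N \<eta> \<zeta> = 0"
proof -
  have "{(i, j). 1 \<le> i \<and> i \<le> j \<and> i + j \<le> N \<and> \<eta> (i + j) > 0 \<and> \<zeta> = fragment \<eta> i j} = {}"
  proof (rule equals0I, clarify)
    fix i j assume "1 \<le> i" "i \<le> j" "\<eta> (i + j) > 0" "\<zeta> = fragment \<eta> i j"
    moreover from this have "1 \<le> j" by simp
    ultimately have "\<eta> \<leadsto> \<zeta>" unfolding neighbours_def by blast
    with assms show False by blast
  qed
  then show ?thesis unfolding P_F_def by (simp only: sum.empty)
qed

lemma gibbs_weight_P_F:
  assumes sym: "\<And>i j. i \<ge> 1 \<Longrightarrow> j \<ge> 1 \<Longrightarrow> \<phi> i j = \<phi> j i"
    and a_pos: "\<And>k. k \<ge> 1 \<Longrightarrow> a k > 0"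
    and \<zeta>: "\<zeta> \<in> partitions_into N (Suc r)"
  shows "(\<Sum>\<eta> \<in> {\<eta> \<in> partitions_into N r. \<eta> \<leadsto> \<zeta>}. gibbs_weight a N \<eta> * P_F \<phi> N \<eta> \<zeta>)
    = gibbs_weight a N \<zeta> * backward_rate a \<phi> N \<zeta>"
proof -
  let ?w = "gibbs_weight a N"
  let ?T = "{(i, j). 1 \<le> i \<and> i \<le> j \<and> i + j \<le> N}"
  let ?c = "\<lambda>i j. total_rate \<phi> N \<zeta> - group_rate \<phi> i - group_rate \<phi> j + group_rate \<phi> (i + j)"
  let ?X = "\<lambda>i j. pair_count \<zeta> i j * (\<phi> i j * a (i + j) / (a i * a j) / ?c i j)"
  let ?Y = "\<lambda>\<eta> i j. if \<eta> (i + j) > 0 \<and> \<zeta> = fragment \<eta> i j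
      then ?w \<eta> * (real (\<eta> (i + j)) * \<phi> i j / total_rate \<phi> N \<eta>) else 0"
  have \<zeta>': "\<zeta> \<in> \<Omega> N" using \<zeta> by (simp add: partitions_into_def)
  \<comment> \<open>Indicators over a fixed index set permit exchanging the sums over
    \<open>\<eta>\<close> and over the pairs.\<close>
  have P: "?w \<eta> * P_F \<phi> N \<eta> \<zeta> = (\<Sum>(i, j) \<in> ?T. ?Y \<eta> i j)" for \<eta>
    unfolding P_F_def sum_distrib_left using finite_pairs_le[of N]
    by (intro sum.mono_neutral_cong_left) (auto split: if_splits)
  \<comment> \<open>A given pair has at most one predecessor, the one with the two groups merged. If
    \<open>\<zeta>\<close> has no such pair of groups, both sides vanish.\<close>
  have inner: "(\<Sum>\<eta>\<in>partitions_into N r. ?Y \<eta> i j) = ?w \<zeta> * ?X i j" if ij: "(i, j) \<in> ?T" for i j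
  proof (cases "\<exists>\<theta>. \<zeta> = add_group j (add_group i \<theta>)")
    case True
    then obtain \<theta> where \<theta>: "\<zeta> = add_group j (add_group i \<theta>)" by blast
    let ?\<eta> = "add_group (i + j) \<theta>"
    have iff: "\<eta> (i + j) > 0 \<and> \<zeta> = fragment \<eta> i j \<longleftrightarrow> \<eta> = ?\<eta>" for \<eta>
      using ij \<theta> fragment_eq_iff[of i j \<eta> \<zeta>] by (auto simp: add_group_inject)
    have "?\<eta> \<in> partitions_into N r"
      using partitions_into_fragment_iff[of i j N \<theta> r] ij \<theta> \<zeta> by simp
    then have "(\<Sum>\<eta>\<in>partitions_into N r. ?Y \<eta> i j)
        = ?w ?\<eta> * (real (?\<eta> (i + j)) * \<phi> i j / total_rate \<phi> N ?\<eta>)"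
      unfolding iff by (simp add: finite_partitions_into)
    also have "total_rate \<phi> N ?\<eta> = ?c i j"
      using ij by (simp add: \<theta> total_rate_add_group)
    also have "?w ?\<eta> * (real (?\<eta> (i + j)) * \<phi> i j / ?c i j)
        = ?w ?\<eta> * real (?\<eta> (i + j)) * (a i * a j) / (a i * a j) * (\<phi> i j / ?c i j)"
      using a_pos[of i] a_pos[of j] ij by simp
    also have "\<dots> = ?w \<zeta> * ?X i j"
      using gibbs_weight_fragment[of i j N a \<theta>] ij unfolding \<theta> by simp
    finally show ?thesis .
  next
    case False
    then have "pair_count \<zeta> i j = 0" using obtain_add_group2 by blast
    moreover have "?Y \<eta> i j = 0" for \<eta>
      using False fragment_eq_iff[of i j \<eta> \<zeta>] ij by (intro if_not_P) auto
    ultimately show ?thesis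
      by (simp only: sum.neutral_const mult_zero_left mult_zero_right)
  qed
  have "(\<Sum>\<eta> \<in> {\<eta> \<in> partitions_into N r. \<eta> \<leadsto> \<zeta>}. ?w \<eta> * P_F \<phi> N \<eta> \<zeta>)
      = (\<Sum>\<eta> \<in> partitions_into N r. ?w \<eta> * P_F \<phi> N \<eta> \<zeta>)"
    using finite_partitions_into P_F_eq_0 by (intro sum.mono_neutral_left) auto
  also have "\<dots> = (\<Sum>\<eta> \<in> partitions_into N r. \<Sum>(i, j) \<in> ?T. ?Y \<eta> i j)"
    by (simp only: P)
  also have "\<dots> = (\<Sum>p \<in> ?T. \<Sum>\<eta> \<in> partitions_into N r. case p of (i, j) \<Rightarrow> ?Y \<eta> i j)"
    by (rule sum.swap)
  also have "\<dots> = (\<Sum>(i, j) \<in> ?T. ?w \<zeta> * ?X i j)"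
    using inner by (intro sum.cong refl) auto
  also have "\<dots> = ?w \<zeta> * (\<Sum>(i, j) \<in> ?T. ?X i j)"
    unfolding sum_distrib_left by (intro sum.cong) auto
  \<comment> \<open>The added pairs have \<open>i + j > N\<close>, so \<open>\<zeta>\<close>
    contains no two groups of these sizes.\<close>
  also have "(\<Sum>(i, j) \<in> ?T. ?X i j) = (\<Sum>(i, j) \<in> {(i, j) \<in> {1..N} \<times> {1..N}. i \<le> j}. ?X i j)"
  proof (rule sum.mono_neutral_left)
    have "pair_count \<zeta> i j = 0" if "\<not> i + j \<le> N" for i j
      using that obtain_add_group2[of \<zeta> i j] partition_add_group2_bounds(3) \<zeta>' by metis
    then show "\<forall>p \<in> {(i, j) \<in> {1..N} \<times> {1..N}. i \<le> j} - ?T. (case p of (i, j) \<Rightarrow> ?X i j) = 0"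
      by fastforce
  qed (auto intro: finite_subset[of _ "{1..N} \<times> {1..N}"])
  also have "\<dots> = (\<Sum>(i, j) \<in> {1..N} \<times> {1..N}. (1 + of_bool (i = j)) * ?X i j) / 2"
  proof (rule sum_triangle_eq_half_square)
    fix i j assume "(i, j) \<in> {1..N} \<times> {1..N}"
    moreover from this have "\<phi> i j = \<phi> j i" by (intro sym) auto
    moreover have "?c i j = ?c j i" by (simp add: add.commute)
    ultimately show "(j, i) \<in> {1..N} \<times> {1..N} \<and> ?X i j = ?X j i"
      by (simp add: pair_count_commute[of \<zeta> i j] add.commute[of i j] mult.commute[of "a i"])
  qed simp
  also have "\<dots> = backward_rate a \<phi> N \<zeta>"
    unfolding backward_rate_def pair_rate_def
    by (intro arg_cong2[where f = "(/)"] sum.cong refl) auto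
  finally show ?thesis .
qed

lemma gibbs_weight_pos:
  assumes "\<And>k. k \<ge> 1 \<Longrightarrow> a k > 0"
  shows "gibbs_weight a N \<eta> > 0"
  unfolding gibbs_weight_def using assms by (intro prod_pos) auto

lemma gibbs_norm_pos:
  assumes "\<And>k. k \<ge> 1 \<Longrightarrow> a k > 0" "\<eta> \<in> partitions_into N r"
  shows "gibbs_norm a N r > 0"
  unfolding gibbs_norm_def using assms
  by (intro sum_pos finite_partitions_into gibbs_weight_pos) auto

text \<open>All ordered pairs of groups, minus each group paired with itself.\<close>

lemma sum_pair_count:
  assumes "finite A"
  shows "(\<Sum>(i, j) \<in> A \<times> A. pair_count \<zeta> i j * F i j)
    = (\<Sum>i\<in>A. real (\<zeta> i) * (\<Sum>j\<in>A. real (\<zeta> j) * F i j)) - (\<Sum>i\<in>A. real (\<zeta> i) * F i i)"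
proof -
  have "(\<Sum>(i, j) \<in> A \<times> A. pair_count \<zeta> i j * F i j)
      = (\<Sum>i\<in>A. \<Sum>j\<in>A. real (\<zeta> i) * (real (\<zeta> j) * F i j) - (if j = i then real (\<zeta> j) * F i j else 0))"
    unfolding sum.cartesian_product[symmetric]
    by (intro sum.cong refl) (auto simp: pair_count_def algebra_simps)
  also have "\<dots> = (\<Sum>i\<in>A. real (\<zeta> i) * (\<Sum>j\<in>A. real (\<zeta> j) * F i j)) - (\<Sum>i\<in>A. real (\<zeta> i) * F i i)"
    using assms by (simp add: sum_subtractf sum_distrib_left)
  finally show ?thesis .
qed

lemma group_rate_1: "group_rate \<phi> (Suc 0) = 0"
proof -
  have "{(i, j). 1 \<le> i \<and> i \<le> j \<and> i + j = Suc 0} = {}" by auto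
  then show ?thesis unfolding group_rate_def by (simp only: sum.empty)
qed

lemma group_rate_2: "group_rate \<phi> 2 = \<phi> 1 1"
proof -
  have "{(i, j). 1 \<le> i \<and> i \<le> j \<and> i + j = (2::nat)} = {(1, 1)}" by auto
  then show ?thesis unfolding group_rate_def by simp
qed

section \<open>The balance equation and sufficiency\<close>

locale fragmentation =
  fixes \<phi> :: "nat \<Rightarrow> nat \<Rightarrow> real" and a :: "nat \<Rightarrow> real"
  assumes phi_sym: "\<And>i j. i \<ge> 1 \<Longrightarrow> j \<ge> 1 \<Longrightarrow> \<phi> i j = \<phi> j i"
    and rate_pos: "\<And>N \<eta>. N \<ge> 2 \<Longrightarrow> \<eta> \<in> \<Omega> N \<Longrightarrow> \<eta> \<noteq> all_singletons N \<Longrightarrow> total_rate \<phi> N \<eta> > 0"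
    and a_pos: "\<And>k. k \<ge> 1 \<Longrightarrow> a k > 0"
begin

definition balanced :: "nat \<Rightarrow> nat \<Rightarrow> (nat \<Rightarrow> nat) \<Rightarrow> bool"
  where "balanced N r \<zeta> \<longleftrightarrow> \<rho> a N (r + 1) \<zeta> =
    (\<Sum>\<eta> \<in> {\<eta> \<in> partitions_into N r. \<eta> \<leadsto> \<zeta>}. \<rho> a N r \<eta> * P_F \<phi> N \<eta> \<zeta>)"

text \<open>The positive weight of \<open>\<zeta>\<close> cancels. If the norm for \<open>r\<close>
  were zero, division by zero would make the right side of the balance equation \<open>0\<close>,
  while the left side is positive.\<close>

lemma balanced_iff:
  assumes \<zeta>: "\<zeta> \<in> partitions_into N (Suc r)"
  shows "balanced N r \<zeta> \<longleftrightarrow>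
    gibbs_norm a N r \<noteq> 0 \<and> gibbs_norm a N r = gibbs_norm a N (Suc r) * backward_rate a \<phi> N \<zeta>"
proof -
  have w: "gibbs_weight a N \<zeta> > 0" by (rule gibbs_weight_pos) (rule a_pos)
  have B: "gibbs_norm a N (Suc r) > 0" by (rule gibbs_norm_pos[OF a_pos \<zeta>])
  have "(\<Sum>\<eta> \<in> {\<eta> \<in> partitions_into N r. \<eta> \<leadsto> \<zeta>}. \<rho> a N r \<eta> * P_F \<phi> N \<eta> \<zeta>)
      = (\<Sum>\<eta> \<in> {\<eta> \<in> partitions_into N r. \<eta> \<leadsto> \<zeta>}. gibbs_weight a N \<eta> * P_F \<phi> N \<eta> \<zeta>) / gibbs_norm a N r"
    unfolding sum_divide_distrib gibbs_def by simp
  also have "\<dots> = gibbs_weight a N \<zeta> * backward_rate a \<phi> N \<zeta> / gibbs_norm a N r"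
    using gibbs_weight_P_F[OF phi_sym a_pos \<zeta>] by simp
  finally show ?thesis
    using w B unfolding balanced_def gibbs_def
    by (cases "gibbs_norm a N r = 0") (auto simp: field_simps)
qed

text \<open>The range of \<open>r\<close> forces \<open>N \<ge> 2\<close> and excludes the partition
  into singletons, which has \<open>N\<close> groups.\<close>

lemma total_rate_pos:
  assumes "\<eta> \<in> partitions_into N r" "r \<in> {1..N - 1}"
  shows "total_rate \<phi> N \<eta> > 0"
proof (rule rate_pos)
  show "\<eta> \<noteq> all_singletons N"
    using assms by (auto simp: partitions_into_def num_groups_def all_singletons_def split: if_splits)
qed (use assms in \<open>auto simp: partitions_into_def\<close>)

lemma sum_P_F:
  assumes \<eta>: "\<eta> \<in> partitions_into N r" and r: "r \<in> {1..N - 1}"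
  shows "(\<Sum>\<zeta>\<in>partitions_into N (Suc r). P_F \<phi> N \<eta> \<zeta>) = 1"
proof -
  let ?T = "{(i, j). 1 \<le> i \<and> i \<le> j \<and> i + j \<le> N}"
  let ?x = "\<lambda>i j. real (\<eta> (i + j)) * \<phi> i j / total_rate \<phi> N \<eta>"
  have "(\<Sum>\<zeta>\<in>partitions_into N (Suc r). P_F \<phi> N \<eta> \<zeta>)
     = (\<Sum>\<zeta>\<in>partitions_into N (Suc r). \<Sum>(i, j) \<in> ?T. if \<eta> (i + j) > 0 \<and> \<zeta> = fragment \<eta> i j then ?x i j else 0)"
    unfolding P_F_def using finite_pairs_le[of N]
    by (intro sum.cong sum.mono_neutral_cong_left) (auto split: if_splits)
  also have "\<dots> = (\<Sum>p \<in> ?T. \<Sum>\<zeta>\<in>partitions_into N (Suc r).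
      case p of (i, j) \<Rightarrow> if \<eta> (i + j) > 0 \<and> \<zeta> = fragment \<eta> i j then ?x i j else 0)"
    by (rule sum.swap)
  also have "\<dots> = (\<Sum>(i, j) \<in> ?T. ?x i j)"
  proof (intro sum.cong refl, clarify)
    fix i j assume ij: "1 \<le> i" "i \<le> j" "i + j \<le> N"
    show "(\<Sum>\<zeta>\<in>partitions_into N (Suc r). if \<eta> (i + j) > 0 \<and> \<zeta> = fragment \<eta> i j then ?x i j else 0) = ?x i j"
    proof (cases "\<eta> (i + j) > 0")
      case True
      then obtain \<theta> where \<theta>: "\<eta> = add_group (i + j) \<theta>" using obtain_add_group by blast
      have "fragment \<eta> i j \<in> partitions_into N (Suc r)"
        using \<eta> \<theta> ij partitions_into_fragment_iff[of i j N \<theta> r] by (simp add: fragment_add_group)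
      with True show ?thesis by (simp add: finite_partitions_into)
    next
      case False
      then show ?thesis by simp
    qed
  qed
  also have "\<dots> = total_rate \<phi> N \<eta> / total_rate \<phi> N \<eta>"
    unfolding total_rate_def[of \<phi> N \<eta>] sum_divide_distrib by (intro sum.cong refl) auto
  also have "\<dots> = 1" using total_rate_pos[OF \<eta> r] by simp
  finally show ?thesis .
qed

text \<open>After exchanging the sums, the outgoing probabilities of each \<open>\<eta>\<close> add
  up to \<open>1\<close>. This identifies a constant backward rate as a ratio of norms.\<close>

lemma sum_backward_rate:
  assumes r: "r \<in> {1..N - 1}"
  shows "(\<Sum>\<zeta>\<in>partitions_into N (Suc r). gibbs_weight a N \<zeta> * backward_rate a \<phi> N \<zeta>) = gibbs_norm a N r"
proof -
  have "(\<Sum>\<zeta>\<in>partitions_into N (Suc r). gibbs_weight a N \<zeta> * backward_rate a \<phi> N \<zeta>)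
      = (\<Sum>\<zeta>\<in>partitions_into N (Suc r). \<Sum>\<eta> \<in> partitions_into N r. gibbs_weight a N \<eta> * P_F \<phi> N \<eta> \<zeta>)"
  proof (intro sum.cong refl)
    fix \<zeta> assume "\<zeta> \<in> partitions_into N (Suc r)"
    from gibbs_weight_P_F[OF phi_sym a_pos this, symmetric]
    have "gibbs_weight a N \<zeta> * backward_rate a \<phi> N \<zeta> =
      (\<Sum>\<eta> \<in> {\<eta> \<in> partitions_into N r. \<eta> \<leadsto> \<zeta>}. gibbs_weight a N \<eta> * P_F \<phi> N \<eta> \<zeta>)" .
    also have "\<dots> = (\<Sum>\<eta> \<in> partitions_into N r. gibbs_weight a N \<eta> * P_F \<phi> N \<eta> \<zeta>)"
      using finite_partitions_into P_F_eq_0 by (intro sum.mono_neutral_left) auto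
    finally show "gibbs_weight a N \<zeta> * backward_rate a \<phi> N \<zeta> =
      (\<Sum>\<eta> \<in> partitions_into N r. gibbs_weight a N \<eta> * P_F \<phi> N \<eta> \<zeta>)" .
  qed
  also have "\<dots> = (\<Sum>\<eta> \<in> partitions_into N r. \<Sum>\<zeta>\<in>partitions_into N (Suc r). gibbs_weight a N \<eta> * P_F \<phi> N \<eta> \<zeta>)"
    by (rule sum.swap)
  also have "\<dots> = gibbs_norm a N r"
    unfolding gibbs_norm_def sum_distrib_left[symmetric] using sum_P_F[OF _ r] by simp
  finally show ?thesis .
qed

lemma total_rate_linear:
  assumes f: "\<And>k. k \<ge> 1 \<Longrightarrow> group_rate \<phi> k = c * (real k - 1)"
    and \<zeta>: "\<zeta> \<in> partitions_into N r"
  shows "total_rate \<phi> N \<zeta> = c * (real N - real r)"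
proof -
  have "total_rate \<phi> N \<zeta> = (\<Sum>m=1..N. c * (real (m * \<zeta> m) - real (\<zeta> m)))"
    unfolding total_rate_eq by (intro sum.cong) (auto simp: f algebra_simps)
  also have "\<dots> = c * (real (\<Sum>m=1..N. m * \<zeta> m) - real (\<Sum>m=1..N. \<zeta> m))"
    by (simp only: sum_subtractf of_nat_sum sum_distrib_left[symmetric])
  finally show ?thesis
    using \<zeta> by (simp add: partitions_into_def partitions_def num_groups_def del: of_nat_sum)
qed

text \<open>All predecessors share one total rate, and summing an affine function of
  \<open>i + j\<close> over pairs of groups involves only the total size and the number of
  groups.\<close>

lemma backward_rate_affine:
  assumes c: "c > 0" and f: "\<And>k. k \<ge> 1 \<Longrightarrow> group_rate \<phi> k = c * (real k - 1)"
    and G: "\<And>i j. i \<ge> 1 \<Longrightarrow> j \<ge> 1 \<Longrightarrow> pair_rate a \<phi> i j = c * (\<alpha> * real (i + j) + \<beta>)"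
    and \<zeta>: "\<zeta> \<in> partitions_into N (Suc r)" and r: "r \<in> {1..N - 1}"
  shows "backward_rate a \<phi> N \<zeta> =
    real r * (2 * \<alpha> * real N + \<beta> * real (Suc r)) / (2 * (real N - real r))"
proof -
  define R where "R = real (Suc r)"
  have R: "(\<Sum>i=1..N. real (\<zeta> i)) = R"
    using \<zeta> unfolding R_def partitions_into_def num_groups_def of_nat_sum[symmetric] by simp
  have W: "(\<Sum>i=1..N. real i * real (\<zeta> i)) = real N"
    using \<zeta> unfolding partitions_into_def partitions_def of_nat_mult[symmetric] of_nat_sum[symmetric] by simp
  have "2 * backward_rate a \<phi> N \<zeta> = (\<Sum>(i, j) \<in> {1..N} \<times> {1..N}. pair_count \<zeta> i j *
      ((\<alpha> * real (i + j) + \<beta>) / (real N - real r)))"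
  proof -
    have "pair_rate a \<phi> i j / (total_rate \<phi> N \<zeta> - group_rate \<phi> i - group_rate \<phi> j + group_rate \<phi> (i + j))
        = (\<alpha> * real (i + j) + \<beta>) / (real N - real r)" if "i \<in> {1..N}" "j \<in> {1..N}" for i j
    proof -
      \<comment> \<open>With \<open>r + 1\<close> groups, \<open>\<zeta>\<close> has rate
        \<open>c * (N - r - 1)\<close>; merging two groups adds exactly \<open>c\<close>.\<close>
      have "total_rate \<phi> N \<zeta> - group_rate \<phi> i - group_rate \<phi> j + group_rate \<phi> (i + j) = c * (real N - real r)"
        using that f[of i] f[of j] f[of "i + j"] total_rate_linear[OF f \<zeta>] by (simp add: algebra_simps)
      with that G c show ?thesis by simp
    qed
    note ratio = this
    have "2 * backward_rate a \<phi> N \<zeta> = (\<Sum>(i, j) \<in> {1..N} \<times> {1..N}. pair_count \<zeta> i j * (pair_rate a \<phi> i j /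
        (total_rate \<phi> N \<zeta> - group_rate \<phi> i - group_rate \<phi> j + group_rate \<phi> (i + j))))"
      unfolding backward_rate_def by simp
    also have "\<dots> = (\<Sum>(i, j) \<in> {1..N} \<times> {1..N}. pair_count \<zeta> i j *
        ((\<alpha> * real (i + j) + \<beta>) / (real N - real r)))"
      by (intro sum.cong refl) (clarify, simp only: ratio)
    finally show ?thesis .
  qed
  also have "\<dots> = (\<Sum>(i, j) \<in> {1..N} \<times> {1..N}. pair_count \<zeta> i j * (\<alpha> * real (i + j) + \<beta>)) / (real N - real r)"
    unfolding sum_divide_distrib by (auto intro!: sum.cong)
  also have "(\<Sum>(i, j) \<in> {1..N} \<times> {1..N}. pair_count \<zeta> i j * (\<alpha> * real (i + j) + \<beta>))
      = (\<Sum>i=1..N. real (\<zeta> i) * (\<Sum>j=1..N. real (\<zeta> j) * (\<alpha> * real (i + j) + \<beta>)))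
        - (\<Sum>i=1..N. real (\<zeta> i) * (\<alpha> * real (i + i) + \<beta>))"
    by (rule sum_pair_count) simp
  also have "(\<Sum>i=1..N. real (\<zeta> i) * (\<alpha> * real (i + i) + \<beta>)) = 2 * \<alpha> * real N + \<beta> * R"
    unfolding R[symmetric] W[symmetric] sum_distrib_left sum.distrib[symmetric]
    by (intro sum.cong) (auto simp: algebra_simps)
  also have "(\<Sum>i=1..N. real (\<zeta> i) * (\<Sum>j=1..N. real (\<zeta> j) * (\<alpha> * real (i + j) + \<beta>)))
      = (\<Sum>i=1..N. \<alpha> * R * (real i * real (\<zeta> i)) + (\<alpha> * real N + \<beta> * R) * real (\<zeta> i))"
  proof (intro sum.cong refl)
    fix i
    have "(\<Sum>j=1..N. real (\<zeta> j) * (\<alpha> * real (i + j) + \<beta>)) = \<alpha> * real i * R + \<alpha> * real N + \<beta> * R"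
      unfolding R[symmetric] W[symmetric] sum_distrib_left sum.distrib[symmetric]
      by (intro sum.cong) (auto simp: algebra_simps)
    then show "real (\<zeta> i) * (\<Sum>j=1..N. real (\<zeta> j) * (\<alpha> * real (i + j) + \<beta>))
        = \<alpha> * R * (real i * real (\<zeta> i)) + (\<alpha> * real N + \<beta> * R) * real (\<zeta> i)"
      by (simp add: algebra_simps)
  qed
  also have "\<dots> = \<alpha> * R * real N + (\<alpha> * real N + \<beta> * R) * R"
    unfolding sum.distrib sum_distrib_left[symmetric] R W by simp
  also have "\<alpha> * R * real N + (\<alpha> * real N + \<beta> * R) * R - (2 * \<alpha> * real N + \<beta> * R)
      = real r * (2 * \<alpha> * real N + \<beta> * real (Suc r))"
    by (simp add: R_def algebra_simps)
  finally have twice: "2 * backward_rate a \<phi> N \<zeta> =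
      real r * (2 * \<alpha> * real N + \<beta> * real (Suc r)) / (real N - real r)" .
  have "backward_rate a \<phi> N \<zeta> = 2 * backward_rate a \<phi> N \<zeta> / 2" by simp
  then show ?thesis by (simp only: twice divide_divide_eq_left mult.commute[of _ 2])
qed

lemma balanced_if_affine:
  assumes c: "c > 0" and \<alpha>: "\<alpha> \<ge> 0" "2 * \<alpha> + \<beta> > 0"
    and f: "\<And>k. k \<ge> 1 \<Longrightarrow> group_rate \<phi> k = c * (real k - 1)"
    and G: "\<And>i j. i \<ge> 1 \<Longrightarrow> j \<ge> 1 \<Longrightarrow> pair_rate a \<phi> i j = c * (\<alpha> * real (i + j) + \<beta>)"
    and \<zeta>: "\<zeta> \<in> partitions_into N (Suc r)" and r: "r \<in> {1..N - 1}"
  shows "balanced N r \<zeta>"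
proof -
  define K where "K = real r * (2 * \<alpha> * real N + \<beta> * real (Suc r)) / (2 * (real N - real r))"
  have S: "backward_rate a \<phi> N \<xi> = K" if "\<xi> \<in> partitions_into N (Suc r)" for \<xi>
    unfolding K_def using backward_rate_affine[OF c f G that r] by simp
  \<comment> \<open>For \<open>K > 0\<close>: since \<open>r + 1 \<le> N\<close> and
    \<open>\<alpha> \<ge> 0\<close>, replacing \<open>N\<close> by \<open>r + 1\<close> does not
    increase the second factor of the numerator.\<close>
  have "0 < (2 * \<alpha> + \<beta>) * real (Suc r)" using \<alpha> by simp
  also have "\<dots> \<le> (2 * \<alpha> + \<beta>) * real (Suc r) + 2 * \<alpha> * (real N - real (Suc r))"
  proof -
    have "real N - real (Suc r) \<ge> 0" using r by auto
    with \<alpha> show ?thesis by simp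
  qed
  also have "\<dots> = 2 * \<alpha> * real N + \<beta> * real (Suc r)" by (simp add: algebra_simps)
  finally have "K > 0" unfolding K_def using r by (intro divide_pos_pos mult_pos_pos) auto
  moreover have "gibbs_norm a N r = gibbs_norm a N (Suc r) * K"
    unfolding sum_backward_rate[OF r, symmetric] using S
    by (simp add: gibbs_norm_def sum_distrib_right)
  moreover have "gibbs_norm a N (Suc r) > 0" by (rule gibbs_norm_pos[OF a_pos \<zeta>])
  ultimately show ?thesis unfolding balanced_iff[OF \<zeta>] using S[OF \<zeta>] by simp
qed

text \<open>Symmetrizing the sum over \<open>i \<le> j\<close> and inserting
  \<open>pair_rate\<close> produces the convolution in the recursion for \<open>a\<close>.\<close>

lemma group_rate_pair_rate:
  assumes k: "k \<ge> 2"
    and G: "\<And>i j. i \<ge> 1 \<Longrightarrow> j \<ge> 1 \<Longrightarrow> pair_rate a \<phi> i j = g (i + j)"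
  shows "2 * a k * group_rate \<phi> k =
    g k * (\<Sum>(i, j) \<in> {(i, j). i \<ge> 1 \<and> j \<ge> 1 \<and> i + j = k}. a i * a j)"
proof -
  let ?P = "{(i, j). i \<ge> 1 \<and> j \<ge> 1 \<and> i + j = k}"
  have fin: "finite ?P" by (rule finite_subset[of _ "{0..k} \<times> {0..k}"]) auto
  have "{(i, j). 1 \<le> i \<and> i \<le> j \<and> i + j = k} = {(i, j) \<in> ?P. i \<le> j}" by auto
  then have "group_rate \<phi> k = (\<Sum>(i, j) \<in> {(i, j) \<in> ?P. i \<le> j}. \<phi> i j)"
    unfolding group_rate_def by simp
  also have "\<dots> = (\<Sum>(i, j) \<in> ?P. (1 + of_bool (i = j)) * \<phi> i j) / 2"
    by (rule sum_triangle_eq_half_square[OF fin]) (auto intro: phi_sym)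
  finally have "2 * a k * group_rate \<phi> k = a k * (\<Sum>(i, j) \<in> ?P. (1 + of_bool (i = j)) * \<phi> i j)"
    by simp
  also have "\<dots> = (\<Sum>(i, j) \<in> ?P. a k * ((1 + of_bool (i = j)) * \<phi> i j))"
    unfolding sum_distrib_left by (intro sum.cong refl) auto
  also have "\<dots> = (\<Sum>(i, j) \<in> ?P. g k * (a i * a j))"
  proof (intro sum.cong refl, clarify)
    fix i j assume ij: "i \<ge> 1" "j \<ge> 1" "k = i + j"
    have "pair_rate a \<phi> i j * (a i * a j) = a (i + j) * ((1 + of_bool (i = j)) * \<phi> i j)"
      unfolding pair_rate_def using a_pos[of i] a_pos[of j] ij by simp
    then show "a (i + j) * ((1 + of_bool (i = j)) * \<phi> i j) = g (i + j) * (a i * a j)"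
      using G[of i j] ij by simp
  qed
  also have "\<dots> = g k * (\<Sum>(i, j) \<in> ?P. a i * a j)"
    unfolding sum_distrib_left by (intro sum.cong refl) auto
  finally show ?thesis .
qed

end

section \<open>Partitions given by lists of group sizes\<close>

lemma count_list_Cons: "count_list (x # xs :: nat list) = add_group x (count_list xs)"
  by (auto simp: add_group_apply fun_eq_iff)

lemma count_list_sum:
  fixes xs :: "nat list"
  assumes "set xs \<subseteq> {1..N}"
  shows "(\<Sum>i=1..N. real (count_list xs i) * h i) = (\<Sum>x\<leftarrow>xs. h x)"
  using assms
proof (induction xs)
  case (Cons x xs)
  then show ?case
    using sum_add_group[OF finite_atLeastAtMost, of x 1 N "count_list xs" h]
    by (simp add: count_list_Cons del: count_list.simps)
qed simp

lemma set_subset_sum_list: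
  fixes xs :: "nat list"
  assumes "\<forall>x\<in>set xs. x \<ge> 1"
  shows "set xs \<subseteq> {1..sum_list xs}"
  using assms by (auto intro: member_le_sum_list)

lemma length_le_sum_list:
  assumes "\<forall>x\<in>set xs. x \<ge> (1::nat)"
  shows "length xs \<le> sum_list xs"
  using assms by (induction xs) auto

lemma count_list_partitions_into:
  assumes "\<forall>x\<in>set xs. x \<ge> 1"
  shows "count_list xs \<in> partitions_into (sum_list xs) (length xs)"
proof -
  have *: "set xs \<subseteq> {1..sum_list xs}" by (rule set_subset_sum_list[OF assms])
  have "real (\<Sum>k=1..sum_list xs. k * count_list xs k) = (\<Sum>x\<leftarrow>xs. real x)"
    unfolding count_list_sum[OF *, symmetric] of_nat_sum by (simp add: mult.commute)
  also have "\<dots> = real (sum_list xs)" by (induction xs) auto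
  finally have "(\<Sum>k=1..sum_list xs. k * count_list xs k) = sum_list xs"
    by (simp only: of_nat_eq_iff)
  moreover have "real (\<Sum>k=1..sum_list xs. count_list xs k) = (\<Sum>x\<leftarrow>xs. 1)"
    unfolding count_list_sum[OF *, symmetric] of_nat_sum by simp
  then have "(\<Sum>k=1..sum_list xs. count_list xs k) = length xs"
    by (simp only: sum_list_triv of_nat_eq_iff mult_1_right)
  moreover have "count_list xs k = 0" if "k \<notin> {1..sum_list xs}" for k
    using * that by (auto simp: count_list_0_iff)
  ultimately show ?thesis
    unfolding partitions_into_def partitions_def num_groups_def by blast
qed

text \<open>Runs over unordered pairs of positions; on lists of known length the simplifier expands
  it completely.\<close>

fun pair_sum :: "('a \<Rightarrow> 'a \<Rightarrow> real) \<Rightarrow> 'a list \<Rightarrow> real"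
  where
    "pair_sum F [] = 0"
  | "pair_sum F (x # xs) = (\<Sum>y\<leftarrow>xs. F x y) + pair_sum F xs"

lemma pair_sum_double:
  assumes "\<And>x y. x \<in> set xs \<Longrightarrow> y \<in> set xs \<Longrightarrow> F x y = F y x"
  shows "2 * pair_sum F xs = (\<Sum>x\<leftarrow>xs. \<Sum>y\<leftarrow>xs. F x y) - (\<Sum>x\<leftarrow>xs. F x x)"
  using assms
proof (induction xs)
  case (Cons x xs)
  have "(\<Sum>y\<leftarrow>xs. F y x) = (\<Sum>y\<leftarrow>xs. F x y)"
    using Cons.prems by (intro arg_cong[where f = sum_list] map_cong refl) auto
  with Cons show ?case by (simp add: sum_list_addf)
qed simp

text \<open>Twice either side sums over ordered pairs of distinct groups. Backward rates of explicit
  partitions become finite expressions.\<close>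

lemma backward_rate_count_list:
  assumes xs: "\<forall>x\<in>set xs. x \<ge> 1"
    and g: "\<And>i j. i \<ge> 1 \<Longrightarrow> j \<ge> 1 \<Longrightarrow> pair_rate a \<phi> i j = pair_rate a \<phi> j i"
  shows "backward_rate a \<phi> (sum_list xs) (count_list xs) =
    pair_sum (\<lambda>i j. pair_rate a \<phi> i j / ((\<Sum>x\<leftarrow>xs. group_rate \<phi> x)
      - group_rate \<phi> i - group_rate \<phi> j + group_rate \<phi> (i + j))) xs"
proof -
  let ?F = "\<lambda>i j. pair_rate a \<phi> i j / ((\<Sum>x\<leftarrow>xs. group_rate \<phi> x)
      - group_rate \<phi> i - group_rate \<phi> j + group_rate \<phi> (i + j))"
  have *: "set xs \<subseteq> {1..sum_list xs}" by (rule set_subset_sum_list[OF xs])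
  have "2 * backward_rate a \<phi> (sum_list xs) (count_list xs)
      = (\<Sum>x\<leftarrow>xs. \<Sum>y\<leftarrow>xs. ?F x y) - (\<Sum>x\<leftarrow>xs. ?F x x)"
    unfolding backward_rate_def total_rate_eq
    using sum_pair_count[of "{1..sum_list xs}" "count_list xs" ?F]
    by (simp only: count_list_sum[OF *] finite_atLeastAtMost) simp
  also have "\<dots> = 2 * pair_sum ?F xs"
    by (rule pair_sum_double[symmetric]) (use g xs in \<open>auto simp: add.commute\<close>)
  finally show ?thesis by simp
qed

context fragmentation
begin

lemma pair_rate_commute: "i \<ge> 1 \<Longrightarrow> j \<ge> 1 \<Longrightarrow> pair_rate a \<phi> i j = pair_rate a \<phi> j i"
  using phi_sym[of i j] by (simp add: pair_rate_def add.commute mult.commute)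

text \<open>This is the total rate of the partition of \<open>k\<close> into a single group.\<close>

lemma group_rate_pos:
  assumes "k \<ge> 2"
  shows "group_rate \<phi> k > 0"
proof -
  have "count_list [k] \<in> partitions_into k 1"
    using count_list_partitions_into[of "[k]"] assms by simp
  then have "total_rate \<phi> k (count_list [k]) > 0"
    using assms by (intro total_rate_pos[of _ _ 1]) auto
  moreover have "total_rate \<phi> k (count_list [k]) = group_rate \<phi> k"
    unfolding total_rate_eq using count_list_sum[of "[k]" k "group_rate \<phi>"] assms by simp
  ultimately show ?thesis by simp
qed

lemma phi_1_1_pos: "\<phi> 1 1 > 0"
  using group_rate_pos[of 2] by (simp add: group_rate_2)

end

section \<open>Necessity: consequences of balance\<close>

locale balanced_fragmentation = fragmentation +
  assumes balanced: "\<And>N r \<zeta>. r \<in> {1..N - 1} \<Longrightarrow> \<zeta> \<in> partitions_into N (Suc r) \<Longrightarrow> balanced N r \<zeta>"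
begin

text \<open>The ratio does not involve \<open>\<zeta>\<close>, so the backward rate is constant on
  the class. Its sign follows because balance makes the nonnegative norm for \<open>r\<close>
  nonzero.\<close>

lemma backward_rate_ratio:
  assumes r: "r \<in> {1..N - 1}" and \<zeta>: "\<zeta> \<in> partitions_into N (Suc r)"
  shows "backward_rate a \<phi> N \<zeta> = gibbs_norm a N r / gibbs_norm a N (Suc r)"
    and "backward_rate a \<phi> N \<zeta> > 0"
proof -
  have B: "gibbs_norm a N (Suc r) > 0" by (rule gibbs_norm_pos[OF a_pos \<zeta>])
  have "gibbs_norm a N r \<noteq> 0" and *: "gibbs_norm a N r = gibbs_norm a N (Suc r) * backward_rate a \<phi> N \<zeta>"
    using balanced[OF r \<zeta>] unfolding balanced_iff[OF \<zeta>] by auto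
  moreover have "gibbs_norm a N r \<ge> 0"
    unfolding gibbs_norm_def using gibbs_weight_pos[OF a_pos] by (intro sum_nonneg) (simp add: less_imp_le)
  ultimately have "gibbs_norm a N r > 0" by linarith
  with * B show "backward_rate a \<phi> N \<zeta> > 0" by (simp add: zero_less_mult_iff)
  from * B show "backward_rate a \<phi> N \<zeta> = gibbs_norm a N r / gibbs_norm a N (Suc r)" by simp
qed

lemma pair_sum_eq:
  assumes xs: "\<forall>x\<in>set xs. x \<ge> 1" and ys: "\<forall>x\<in>set ys. x \<ge> 1"
    and len: "length xs \<ge> 2" "length ys = length xs" and sum: "sum_list ys = sum_list xs"
  shows "pair_sum (\<lambda>i j. pair_rate a \<phi> i j / ((\<Sum>x\<leftarrow>xs. group_rate \<phi> x)
      - group_rate \<phi> i - group_rate \<phi> j + group_rate \<phi> (i + j))) xs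
    = pair_sum (\<lambda>i j. pair_rate a \<phi> i j / ((\<Sum>x\<leftarrow>ys. group_rate \<phi> x)
      - group_rate \<phi> i - group_rate \<phi> j + group_rate \<phi> (i + j))) ys"
proof -
  let ?r = "length xs - 1"
  have s: "Suc ?r = length xs" using len by linarith
  have r: "?r \<in> {1..sum_list xs - 1}" using len length_le_sum_list[OF xs] by auto
  have "count_list xs \<in> partitions_into (sum_list xs) (Suc ?r)"
    unfolding s by (rule count_list_partitions_into[OF xs])
  moreover have "count_list ys \<in> partitions_into (sum_list xs) (Suc ?r)"
    using count_list_partitions_into[OF ys] unfolding s len sum .
  ultimately have "backward_rate a \<phi> (sum_list xs) (count_list xs) = backward_rate a \<phi> (sum_list ys) (count_list ys)"
    using backward_rate_ratio(1)[OF r] sum by simp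
  then show ?thesis
    by (simp only: backward_rate_count_list[OF xs pair_rate_commute] backward_rate_count_list[OF ys pair_rate_commute])
qed

text \<open>This is \<open>g(m)\<close>, read off at the pair \<open>1\<close>,
  \<open>m - 1\<close>; it is meaningful for \<open>m \<ge> 2\<close>.\<close>

definition sum_rate :: "nat \<Rightarrow> real"
  where "sum_rate m = pair_rate a \<phi> 1 (m - 1)"

text \<open>Two groups can only merge into the single group \<open>i + j\<close>, so equal backward
  rates of \<open>[i, j]\<close> and \<open>[1, i + j - 1]\<close> mean equal pair rates.\<close>

lemma pair_rate_eq:
  assumes "i \<ge> 1" "j \<ge> 1"
  shows "pair_rate a \<phi> i j = sum_rate (i + j)"
  using pair_sum_eq[of "[i, j]" "[1, i + j - 1]"] group_rate_pos[of "i + j"] assms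
  by (simp add: sum_rate_def)

lemma sum_rate_pos:
  assumes "m \<ge> 2"
  shows "sum_rate m > 0"
proof -
  let ?xs = "[1, m - 1]"
  have xs: "\<forall>x\<in>set ?xs. x \<ge> 1" and m: "sum_list ?xs = m" using assms by auto
  have "count_list ?xs \<in> partitions_into m (Suc 1)"
    using count_list_partitions_into[OF xs] m by simp
  then have "backward_rate a \<phi> m (count_list ?xs) > 0"
    using assms by (intro backward_rate_ratio(2)[of 1]) auto
  moreover have "backward_rate a \<phi> m (count_list ?xs) = sum_rate m / group_rate \<phi> m"
    using backward_rate_count_list[OF xs pair_rate_commute] m assms by (simp add: sum_rate_def)
  ultimately show ?thesis using group_rate_pos[OF assms] by (simp add: zero_less_divide_iff)
qed

text \<open>The partitions \<open>{k + 1, 1, 1\<^sup>n}\<close> and \<open>{k, 2, 1\<^sup>n}\<close> lie in the same class, and both backward rates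
  are quadratic in \<open>n\<close>. The leading coefficients, which come from merging two of the \<open>n\<close>
  singletons, must agree; \<open>n = 1, 2\<close> suffice because the case \<open>n = 0\<close> holds trivially.\<close>

lemma group_rate_Suc:
  assumes "k \<ge> 2"
  shows "group_rate \<phi> (Suc k) = group_rate \<phi> k + group_rate \<phi> 2"
proof -
  define f where "f = group_rate \<phi>"
  \<comment> \<open>Terms by merged pair: \<open>H\<close> for \<open>k + 1, 1\<close> and for
    \<open>k, 2\<close>; \<open>J\<close> for \<open>k, 1\<close>; \<open>L\<close> for
    \<open>2, 1\<close>; \<open>A\<close> and \<open>A'\<close> for two singletons in the first and
    second partition.\<close>
  define H where "H = sum_rate (k + 2) / f (k + 2)"
  define J where "J = sum_rate (k + 1) / (f 2 + f (k + 1))"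
  define L where "L = sum_rate 3 / (f k + f 3)"
  define A where "A = sum_rate 2 / (f 2 + f (k + 1))"
  define A' where "A' = sum_rate 2 / (f k + 2 * f 2)"
  note defs = H_def J_def L_def A_def A'_def
  have f1: "f (Suc 0) = 0" by (simp add: f_def group_rate_1)
  have s: "Suc (Suc 0) = 2" "Suc 2 = 3" by simp_all
  have "2 * H + A = H + J + L"
    using pair_sum_eq[of "[k + 1, 1, 1]" "[k, 2, 1]", folded f_def] assms
    by (simp add: defs pair_rate_eq f1 s algebra_simps)
  moreover have "3 * H + 3 * A = H + 2 * J + 2 * L + A'"
    using pair_sum_eq[of "[k + 1, 1, 1, 1]" "[k, 2, 1, 1]", folded f_def] assms
    by (simp add: defs pair_rate_eq f1 s algebra_simps)
  \<comment> \<open>The first relation reads \<open>H + A = J + L\<close>; inserting its double into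
    the second leaves \<open>A = A'\<close>.\<close>
  ultimately have "A = A'" by linarith
  moreover have "sum_rate 2 > 0" "f 2 + f (k + 1) > 0" "f k + 2 * f 2 > 0"
    using assms by (auto simp: f_def intro!: sum_rate_pos add_pos_pos group_rate_pos)
  ultimately have "f (k + 1) = f k + f 2"
    unfolding A_def A'_def by (simp add: frac_eq_eq)
  then show ?thesis by (simp add: f_def)
qed

lemma group_rate_linear:
  assumes "k \<ge> 1"
  shows "group_rate \<phi> k = \<phi> 1 1 * (real k - 1)"
proof (cases "k = 1")
  case False
  with assms have "k \<ge> 2" by simp
  then show ?thesis
  proof (induction k rule: dec_induct)
    case (step n)
    then show ?case using group_rate_Suc[of n] by (simp add: group_rate_2 algebra_simps)
  qed (simp add: group_rate_2)
qed (simp add: group_rate_1)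

text \<open>With equal total rates only the numerators count:
  \<open>g(2) + 2 g(k + 3) = g(3) + g(k + 2) + g(k + 3)\<close>, so \<open>g\<close> has constant
  increments.\<close>

lemma sum_rate_affine: "sum_rate (k + 2) = sum_rate 2 + real k * (sum_rate 3 - sum_rate 2)"
proof (induction k)
  case (Suc k)
  \<comment> \<open>The total rate of every partition of \<open>k + 4\<close> into two
    groups.\<close>
  define c where "c = \<phi> 1 1 * (real k + 2)"
  have c: "c > 0" unfolding c_def using phi_1_1_pos by simp
  have s: "Suc (Suc 0) = 2" "Suc 2 = 3" by simp_all
  have "(sum_rate 2 + 2 * sum_rate (Suc k + 2)) / c = (sum_rate 3 + sum_rate (k + 2) + sum_rate (Suc k + 2)) / c"
    using pair_sum_eq[of "[1, 1, k + 2]" "[1, 2, k + 1]"]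
    by (simp add: pair_rate_eq group_rate_linear c_def algebra_simps add_divide_distrib s)
  with c Suc show ?case by (simp add: algebra_simps)
qed (simp add: numeral_2_eq_2)

lemma affine_coefficients:
  obtains \<alpha> \<beta> where "\<alpha> \<ge> 0" "2 * \<alpha> + \<beta> > 0"
    "\<And>i j. i \<ge> 1 \<Longrightarrow> j \<ge> 1 \<Longrightarrow> pair_rate a \<phi> i j = \<phi> 1 1 * (\<alpha> * real (i + j) + \<beta>)"
proof
  define d where "d = sum_rate 3 - sum_rate 2"
  \<comment> \<open>Chosen so that \<open>2 * ?\<alpha> + ?\<beta>\<close> is
    \<open>sum_rate 2 / \<phi> 1 1\<close>.\<close>
  let ?\<alpha> = "d / \<phi> 1 1" and ?\<beta> = "(sum_rate 2 - 2 * d) / \<phi> 1 1"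
  \<comment> \<open>With a negative slope the positive \<open>sum_rate\<close> would eventually
    become negative.\<close>
  have "d \<ge> 0"
  proof (rule ccontr)
    assume "\<not> d \<ge> 0"
    then obtain k where "real k * (- d) > sum_rate 2"
      using reals_Archimedean3[of "- d"] by auto
    moreover have "sum_rate (k + 2) > 0" by (rule sum_rate_pos) simp
    ultimately show False using sum_rate_affine[of k] by (simp add: d_def algebra_simps)
  qed
  then show "?\<alpha> \<ge> 0" using phi_1_1_pos by simp
  show "2 * ?\<alpha> + ?\<beta> > 0"
    using sum_rate_pos[of 2] phi_1_1_pos by (simp add: add_divide_distrib[symmetric])
  fix i j :: nat assume ij: "i \<ge> 1" "j \<ge> 1"
  define k where "k = i + j - 2"
  have k: "i + j = k + 2" using ij by (simp add: k_def)
  have "pair_rate a \<phi> i j = d * real (i + j) + (sum_rate 2 - 2 * d)"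
    unfolding pair_rate_eq[OF ij] k sum_rate_affine d_def[symmetric] by (simp add: algebra_simps)
  also have "\<dots> = \<phi> 1 1 * (?\<alpha> * real (i + j) + ?\<beta>)"
    using phi_1_1_pos by (simp add: distrib_left)
  finally show "pair_rate a \<phi> i j = \<phi> 1 1 * (?\<alpha> * real (i + j) + ?\<beta>)" .
qed

end

section \<open>Translation into formulas for the weights and rates\<close>

context fragmentation
begin

lemma pair_rate_eq_iff:
  assumes "i \<ge> 1" "j \<ge> 1"
  shows "pair_rate a \<phi> i j = c * s \<longleftrightarrow>
    (if i = j then \<phi> i i = c * ((a i)\<^sup>2 / (2 * a (2 * i))) * s
     else \<phi> i j = c * (a i * a j / a (i + j)) * s)"
proof -
  have pos: "a i > 0" "a j > 0" "a (i + j) > 0" using assms by (auto intro!: a_pos)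
  have solve: "x * A / P = c * s \<longleftrightarrow> x = c * (P / A) * s" if "A > 0" "P > 0" for x A P :: real
    using that by (simp add: divide_eq_eq eq_divide_eq mult_ac)
  show ?thesis
  proof (cases "i = j")
    case True
    have "pair_rate a \<phi> i i = \<phi> i i * (2 * a (2 * i)) / (a i)\<^sup>2"
      unfolding pair_rate_def mult_2[of i] by (simp add: power2_eq_square)
    moreover have "2 * a (2 * i) > 0" "(a i)\<^sup>2 > 0"
      using pos True unfolding mult_2[of i] by simp_all
    ultimately show ?thesis
      using solve[of "2 * a (2 * i)" "(a i)\<^sup>2" "\<phi> i i"] True by (simp only: if_True simp_thms)
  next
    case False
    then show ?thesis
      using solve[of "a (i + j)" "a i * a j" "\<phi> i j"] pos by (simp add: pair_rate_def)
  qed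
qed

text \<open>For affine \<open>g\<close>, linearity of \<open>f\<close> is the recursion: multiply by
  \<open>2 * a k > 0\<close>, insert \<open>group_rate_pair_rate\<close> and cancel
  \<open>\<phi> 1 1 > 0\<close>.\<close>

lemma weight_recursion_iff:
  assumes k: "k \<ge> 2"
    and G: "\<And>i j. i \<ge> 1 \<Longrightarrow> j \<ge> 1 \<Longrightarrow> pair_rate a \<phi> i j = \<phi> 1 1 * (\<alpha> * real (i + j) + \<beta>)"
  shows "group_rate \<phi> k = \<phi> 1 1 * (real k - 1) \<longleftrightarrow>
    a k = (\<alpha> * real k + \<beta>) * (\<Sum>(i, j) \<in> {(i, j). i \<ge> 1 \<and> j \<ge> 1 \<and> i + j = k}. a i * a j)
      / (2 * (real k - 1))"
proof -
  define S where "S = (\<Sum>(i, j) \<in> {(i, j). i \<ge> 1 \<and> j \<ge> 1 \<and> i + j = k}. a i * a j)"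
  have *: "2 * a k * group_rate \<phi> k = \<phi> 1 1 * ((\<alpha> * real k + \<beta>) * S)"
    using group_rate_pair_rate[OF k, of "\<lambda>m. \<phi> 1 1 * (\<alpha> * real m + \<beta>)"] G
    by (simp add: S_def mult.assoc)
  have "group_rate \<phi> k = \<phi> 1 1 * (real k - 1) \<longleftrightarrow>
      2 * a k * group_rate \<phi> k = 2 * a k * (\<phi> 1 1 * (real k - 1))"
    using a_pos[of k] k by simp
  also have "\<dots> \<longleftrightarrow> \<phi> 1 1 * (a k * (2 * (real k - 1))) = \<phi> 1 1 * ((\<alpha> * real k + \<beta>) * S)"
    unfolding * by (auto simp: algebra_simps)
  also have "\<dots> \<longleftrightarrow> a k * (2 * (real k - 1)) = (\<alpha> * real k + \<beta>) * S"
    using phi_1_1_pos by simp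
  also have "\<dots> \<longleftrightarrow> a k = (\<alpha> * real k + \<beta>) * S / (2 * (real k - 1))"
    using k by (simp add: eq_divide_eq)
  finally show ?thesis unfolding S_def .
qed

end

theorem proposition3:
  fixes \<phi> :: "nat \<Rightarrow> nat \<Rightarrow> real" and a :: "nat \<Rightarrow> real"
  assumes phi_sym: "\<And>i j. i \<ge> 1 \<Longrightarrow> j \<ge> 1 \<Longrightarrow> \<phi> i j = \<phi> j i"
    and phi_nonneg: "\<And>i j. i \<ge> 1 \<Longrightarrow> j \<ge> 1 \<Longrightarrow> \<phi> i j \<ge> 0"
    and rate_pos: "\<And>N \<eta>. N \<ge> 2 \<Longrightarrow> \<eta> \<in> \<Omega> N \<Longrightarrow> \<eta> \<noteq> all_singletons N \<Longrightarrow> total_rate \<phi> N \<eta> > 0"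
    and a_pos: "\<And>k. k \<ge> 1 \<Longrightarrow> a k > 0"
    and a_1: "a 1 = 1"
  shows
    "(\<forall>N\<ge>1. \<forall>r\<in>{1..N - 1}. \<forall>\<zeta>\<in>partitions_into N (r + 1).
        \<rho> a N (r + 1) \<zeta> =
          (\<Sum>\<eta> \<in> {\<eta> \<in> partitions_into N r. \<eta> \<leadsto> \<zeta>}. \<rho> a N r \<eta> * P_F \<phi> N \<eta> \<zeta>))
     \<longleftrightarrow>
     (\<exists>\<alpha> \<beta> :: real. \<alpha> \<ge> 0 \<and> 2 * \<alpha> + \<beta> > 0 \<and>
        a 1 = 1 \<and>
        (\<forall>k\<ge>2. a k =
            (\<alpha> * real k + \<beta>) * (\<Sum>(i, j) \<in> {(i, j). i \<ge> 1 \<and> j \<ge> 1 \<and> i + j = k}. a i * a j)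
              / (2 * (real k - 1))) \<and>
        (\<forall>i\<ge>1. \<forall>j\<ge>1. i \<noteq> j \<longrightarrow>
            \<phi> i j = \<phi> 1 1 * (a i * a j / a (i + j)) * (\<alpha> * real (i + j) + \<beta>)) \<and>
        (\<forall>i\<ge>1. \<phi> i i = \<phi> 1 1 * ((a i)\<^sup>2 / (2 * a (2 * i))) * (2 * \<alpha> * real i + \<beta>)))"
    (is "?L \<longleftrightarrow> (\<exists>\<alpha> \<beta>. ?R \<alpha> \<beta>)")
proof -
  interpret fragmentation \<phi> a
    by unfold_locales (fact phi_sym rate_pos a_pos)+
  \<comment> \<open>Restates the right side through \<open>group_rate\<close> and
    \<open>pair_rate\<close>, the form in which both directions are proved.\<close>
  have R_iff: "?R \<alpha> \<beta> \<longleftrightarrow> \<alpha> \<ge> 0 \<and> 2 * \<alpha> + \<beta> > 0 \<and>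
      (\<forall>k\<ge>2. group_rate \<phi> k = \<phi> 1 1 * (real k - 1)) \<and>
      (\<forall>i\<ge>1. \<forall>j\<ge>1. pair_rate a \<phi> i j = \<phi> 1 1 * (\<alpha> * real (i + j) + \<beta>))" (is "_ \<longleftrightarrow> ?M") for \<alpha> \<beta>
  proof -
    let ?G = "\<forall>i\<ge>1. \<forall>j\<ge>1. pair_rate a \<phi> i j = \<phi> 1 1 * (\<alpha> * real (i + j) + \<beta>)"
    have "?G \<longleftrightarrow> (\<forall>i\<ge>1. \<forall>j\<ge>1. i \<noteq> j \<longrightarrow>
            \<phi> i j = \<phi> 1 1 * (a i * a j / a (i + j)) * (\<alpha> * real (i + j) + \<beta>)) \<and>
        (\<forall>i\<ge>1. \<phi> i i = \<phi> 1 1 * ((a i)\<^sup>2 / (2 * a (2 * i))) * (2 * \<alpha> * real i + \<beta>))" (is "_ \<longleftrightarrow> ?H")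
    proof -
      have "\<alpha> * real (i + i) + \<beta> = 2 * \<alpha> * real i + \<beta>" for i by simp
      then show ?thesis by (simp only: pair_rate_eq_iff cong: imp_cong) metis
    qed
    moreover have "(\<forall>k\<ge>2. group_rate \<phi> k = \<phi> 1 1 * (real k - 1)) \<longleftrightarrow> (\<forall>k\<ge>2. a k =
            (\<alpha> * real k + \<beta>) * (\<Sum>(i, j) \<in> {(i, j). i \<ge> 1 \<and> j \<ge> 1 \<and> i + j = k}. a i * a j)
              / (2 * (real k - 1)))" if ?G
      using weight_recursion_iff[of _ \<alpha> \<beta>] that by blast
    ultimately show ?thesis using a_1 by blast
  qed
  show ?thesis
  proof
    assume L: ?L
    interpret balanced_fragmentation \<phi> a
    proof unfold_locales
      fix N r \<zeta> assume "r \<in> {1..N - 1}" "\<zeta> \<in> partitions_into N (Suc r)"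
      moreover from this have "N \<ge> 1" by auto
      ultimately show "balanced N r \<zeta>" unfolding balanced_def using L by simp
    qed
    obtain \<alpha> \<beta> where "\<alpha> \<ge> 0" "2 * \<alpha> + \<beta> > 0"
      "\<And>i j. i \<ge> 1 \<Longrightarrow> j \<ge> 1 \<Longrightarrow> pair_rate a \<phi> i j = \<phi> 1 1 * (\<alpha> * real (i + j) + \<beta>)"
      by (rule affine_coefficients) (rule that)
    then have "?R \<alpha> \<beta>" unfolding R_iff using group_rate_linear by simp
    then show "\<exists>\<alpha> \<beta>. ?R \<alpha> \<beta>" by blast
  next
    assume "\<exists>\<alpha> \<beta>. ?R \<alpha> \<beta>"
    then obtain \<alpha> \<beta> where \<alpha>: "\<alpha> \<ge> 0" "2 * \<alpha> + \<beta> > 0"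
      and f: "\<forall>k\<ge>2. group_rate \<phi> k = \<phi> 1 1 * (real k - 1)"
      and G: "\<forall>i\<ge>1. \<forall>j\<ge>1. pair_rate a \<phi> i j = \<phi> 1 1 * (\<alpha> * real (i + j) + \<beta>)"
      unfolding R_iff by blast
    \<comment> \<open>At \<open>k = 1\<close> both sides are \<open>0\<close>.\<close>
    have f': "group_rate \<phi> k = \<phi> 1 1 * (real k - 1)" if "k \<ge> 1" for k
      using f that by (cases "k = 1") (auto simp: group_rate_1)
    show ?L
    proof (intro allI impI ballI)
      fix N r \<zeta> assume "r \<in> {1..N - 1}" "\<zeta> \<in> partitions_into N (r + 1)"
      then have "balanced N r \<zeta>"
        by (intro balanced_if_affine[OF phi_1_1_pos \<alpha> f' G[rule_format]]) auto
      then show "\<rho> a N (r + 1) \<zeta> =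
          (\<Sum>\<eta> \<in> {\<eta> \<in> partitions_into N r. \<eta> \<leadsto> \<zeta>}. \<rho> a N r \<eta> * P_F \<phi> N \<eta> \<zeta>)"
        unfolding balanced_def .
    qed
  qed
qed

end
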